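(* Let $N\ge 5$ be an integer. Consider the following procedure. Step 1: set $(d,\beta)=(4N,0)$, or, when $N\equiv 3\pmod 4$, alternatively $(d,\beta)=(N,N)$. Step 2: starting from a primitive reduced positive definite form $Q^{\mathrm{red}}$ of discriminant $-d$, find a form $[a,b,c]$ that is $\mathrm{SL}_2(\mathbb Z)$-equivalent to $Q^{\mathrm{red}}$ and satisfies $\gcd(a,N)=1$. Step 3: set $[A,B,C]:=[a,b,c]\circ\begin{pmatrix}K&-1\\1&0\end{pmatrix}$, where $K$ is a solution of the linear congruence $2aX+b\equiv-\beta\pmod{2N}$. Step 4: set $\tau=\frac{-B+\sqrt{-d}}{2A}\in\mathfrak H$. Then Steps 2 and 3 can always be carried out, the form $[A,B,C]$ satisfies $N\mid A$ and $B\equiv\beta\pmod{2N}$, and $\Gamma_0(N)\tau$ is a fixed point of $W_N$ on $X_0(N)$. Moreover, different choices of the pair consisting of $(d,\beta)$ and the reduced form $Q^{\mathrm{red}}$ produce $\Gamma_0(N)$-inequivalent fixed points.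
   Context: $\mathfrak H$ is the complex upper half plane, $\Gamma_0(N)=\{\begin{pmatrix}a&b\\c&d\end{pmatrix}\in \mathrm{SL}_2(\mathbb Z): c\equiv 0 \pmod N\}$, and $X_0(N)$ is the compact Riemann surface obtained by compactifying $\Gamma_0(N)\backslash\mathfrak H$. $W_N$ is the full Atkin-Lehner involution of $X_0(N)$, induced by $\tau\mapsto -1/(N\tau)$. $[a,b,c]$ denotes the integral binary quadratic form $ax^2+bxy+cy^2$, of discriminant $b^2-4ac$; it is primitive if $\gcd(a,b,c)=1$. $\mathrm{SL}_2(\mathbb Z)$ acts by $(F\circ\gamma)(x,y)=F(px+qy,rx+sy)$ for $\gamma=\begin{pmatrix}p&q\\ r&s\end{pmatrix}$ (and the same formula defines $F\circ\gamma$). A primitive positive definite form $[a,b,c]$ is reduced if $|b|\le a\le c$, and $b\ge 0$ whenever $|b|=a$ or $a=c$. *)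

theory Defs
  imports "HOL-Analysis.Analysis" "HOL-Number_Theory.Cong"
begin

section \<open>Integral binary quadratic forms\<close>

datatype bqf = BQF (cA: int) (cB: int) (cC: int)

definition bqf_eval :: "bqf \<Rightarrow> int \<Rightarrow> int \<Rightarrow> int" where
  "bqf_eval F x y = cA F * x^2 + cB F * x * y + cC F * y^2"

definition bqf_disc :: "bqf \<Rightarrow> int" where
  "bqf_disc F = (cB F)^2 - 4 * cA F * cC F"

definition bqf_primitive :: "bqf \<Rightarrow> bool" where
  "bqf_primitive F \<longleftrightarrow> gcd (cA F) (gcd (cB F) (cC F)) = 1"

definition bqf_pos_def :: "bqf \<Rightarrow> bool" where
  "bqf_pos_def F \<longleftrightarrow> (\<forall>x y. (x, y) \<noteq> (0, 0) \<longrightarrow> bqf_eval F x y > 0)"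

definition bqf_reduced :: "bqf \<Rightarrow> bool" where
  "bqf_reduced F \<longleftrightarrow> bqf_primitive F \<and> bqf_pos_def F \<and>
     \<bar>cB F\<bar> \<le> cA F \<and> cA F \<le> cC F \<and>
     (\<bar>cB F\<bar> = cA F \<or> cA F = cC F \<longrightarrow> cB F \<ge> 0)"

definition mat2 :: "int \<Rightarrow> int \<Rightarrow> int \<Rightarrow> int \<Rightarrow> int^2^2" where
  "mat2 p q r s = vector [vector [p, q], vector [r, s]]"

text \<open>The coefficients of \<open>F \<circ> \<gamma>\<close>; they are obtained by expanding
  \<open>F(px+qy, rx+sy)\<close>, see \<open>bqf_eval_comp\<close> and \<open>bqf_eval_inject\<close> below.\<close>

definition bqf_comp :: "bqf \<Rightarrow> int^2^2 \<Rightarrow> bqf" where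
  "bqf_comp F M =
     (let p = M$1$1; q = M$1$2; r = M$2$1; s = M$2$2 in
      BQF (cA F * p^2 + cB F * p * r + cC F * r^2)
          (2 * cA F * p * q + cB F * (p * s + q * r) + 2 * cC F * r * s)
          (cA F * q^2 + cB F * q * s + cC F * s^2))"

lemma bqf_eval_comp:
  "bqf_eval (bqf_comp F M) x y = bqf_eval F (M$1$1 * x + M$1$2 * y) (M$2$1 * x + M$2$2 * y)"
  by (simp add: bqf_eval_def bqf_comp_def Let_def power2_eq_square algebra_simps)

lemma bqf_eval_inject: "bqf_eval F = bqf_eval G \<longleftrightarrow> F = G"
proof
  assume eq: "bqf_eval F = bqf_eval G"
  have "bqf_eval F 1 0 = bqf_eval G 1 0" "bqf_eval F 0 1 = bqf_eval G 0 1"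
       "bqf_eval F 1 1 = bqf_eval G 1 1"
    by (simp_all add: eq)
  then show "F = G"
    by (cases F; cases G) (simp add: bqf_eval_def)
qed simp

definition SL2Z :: "(int^2^2) set" where
  "SL2Z = {M. det M = 1}"

definition bqf_equiv :: "bqf \<Rightarrow> bqf \<Rightarrow> bool" where
  "bqf_equiv F G \<longleftrightarrow> (\<exists>M\<in>SL2Z. G = bqf_comp F M)"

section \<open>The points of $X_0(N)$ and the Atkin--Lehner involution $W_N$\<close>

definition Gamma0 :: "int \<Rightarrow> (int^2^2) set" where
  "Gamma0 N = {M \<in> SL2Z. N dvd M$2$1}"

definition upper_half_plane :: "complex set" where
  "upper_half_plane = {z. Im z > 0}"

text \<open>Points of the Riemann sphere, on which 2 by 2 matrices act by Moebius transformations.\<close>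

datatype sphere = Fin complex | Infty

definition moebius :: "int^2^2 \<Rightarrow> sphere \<Rightarrow> sphere" where
  "moebius M P =
     (case P of
        Fin z \<Rightarrow>
          if of_int (M$2$1) * z + of_int (M$2$2) = 0 then Infty
          else Fin ((of_int (M$1$1) * z + of_int (M$1$2)) / (of_int (M$2$1) * z + of_int (M$2$2)))
      | Infty \<Rightarrow>
          if M$2$1 = 0 then Infty else Fin (of_int (M$1$1) / of_int (M$2$1)))"

text \<open>The extended upper half plane: the upper half plane together with the cusps, i.e. the
  rational numbers and infinity.\<close>

definition extended_half_plane :: "sphere set" where
  "extended_half_plane = Fin ` upper_half_plane \<union> Fin ` \<rat> \<union> {Infty}"

definition Gamma0_rel :: "int \<Rightarrow> (sphere \<times> sphere) set" where
  "Gamma0_rel N = {(P, Q). P \<in> extended_half_plane \<and> Q \<in> extended_half_plane \<and>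
                           (\<exists>M\<in>Gamma0 N. Q = moebius M P)}"

definition orbit :: "int \<Rightarrow> sphere \<Rightarrow> sphere set" where
  "orbit N P = Gamma0_rel N `` {P}"

text \<open>The set of points of the compactified quotient; its elements are the orbits, including
  those of the cusps. The complex structure plays no role for fixed points.\<close>

definition X0 :: "int \<Rightarrow> sphere set set" where
  "X0 N = extended_half_plane // Gamma0_rel N"

definition fricke :: "int \<Rightarrow> int^2^2" where
  "fricke N = mat2 0 (-1) N 0"

text \<open>The map induced on orbits by \<open>\<tau> \<mapsto> -1/(N\<tau>)\<close>; by \<open>atkin_lehner_orbit\<close> below the image
  of the orbit of a point is the orbit of the image of that point.\<close>

definition atkin_lehner :: "int \<Rightarrow> sphere set \<Rightarrow> sphere set" where
  "atkin_lehner N P = moebius (fricke N) ` P"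

lemma mat2_nth [simp]:
  "mat2 p q r s $ 1 $ 1 = p" "mat2 p q r s $ 1 $ 2 = q"
  "mat2 p q r s $ 2 $ 1 = r" "mat2 p q r s $ 2 $ 2 = s"
  by (simp_all add: mat2_def)

lemma moebius_fricke:
  "z \<noteq> 0 \<Longrightarrow> N \<noteq> 0 \<Longrightarrow> moebius (fricke N) (Fin z) = Fin (-1 / (of_int N * z))"
  by (simp add: moebius_def fricke_def)

lemma matrix_mult_2:
  fixes A B :: "int^2^2"
  shows "(A ** B) $ i $ j = A$i$1 * B$1$j + A$i$2 * B$2$j"
  by (simp add: matrix_matrix_mult_def sum_2)

lemma moebius_mult:
  assumes "det A \<noteq> 0" "det B \<noteq> 0"
  shows "moebius (A ** B) P = moebius A (moebius B P)"
proof -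
  define p q r s where "p = B$1$1" and "q = B$1$2" and "r = B$2$1" and "s = B$2$2"
  define a b c d where "a = A$1$1" and "b = A$1$2" and "c = A$2$1" and "d = A$2$2"
  define u v :: complex where
    "u = (case P of Fin z \<Rightarrow> of_int p * z + of_int q | Infty \<Rightarrow> of_int p)" and
    "v = (case P of Fin z \<Rightarrow> of_int r * z + of_int s | Infty \<Rightarrow> of_int r)"
  define pt where "pt = (\<lambda>x y :: complex. if y = 0 then Infty else Fin (x / y))"
  have dB: "of_int p * of_int s - of_int q * of_int r \<noteq> (0::complex)"
    using assms(2) unfolding det_2
    by (simp flip: of_int_mult of_int_diff add: p_def q_def r_def s_def)
  have dA: "of_int a * of_int d - of_int b * of_int c \<noteq> (0::complex)"
    using assms(1) unfolding det_2
    by (simp flip: of_int_mult of_int_diff add: a_def b_def c_def d_def)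
  have uv: "u \<noteq> 0 \<or> v \<noteq> 0"
  proof (cases P)
    case (Fin z)
    have "of_int p * of_int s - of_int q * of_int r
            = of_int p * v - of_int r * u"
      by (simp add: Fin u_def v_def algebra_simps)
    then show ?thesis using dB by auto
  next
    case Infty
    then show ?thesis using dB by (auto simp: u_def v_def)
  qed
  have 1: "moebius B P = pt u v"
    by (cases P) (simp_all add: moebius_def pt_def u_def v_def p_def q_def r_def s_def)
  have 2: "moebius A (pt u v) = pt (of_int a * u + of_int b * v) (of_int c * u + of_int d * v)"
  proof (cases "v = 0")
    case True
    then show ?thesis using uv
      by (simp add: moebius_def pt_def a_def b_def c_def d_def)
  next
    case False
    have "of_int c * (u / v) + of_int d = (of_int c * u + of_int d * v) / v"
         "of_int a * (u / v) + of_int b = (of_int a * u + of_int b * v) / v"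
      using False by (simp_all add: field_simps)
    then show ?thesis using False
      by (simp add: moebius_def pt_def flip: a_def b_def c_def d_def)
  qed
  have int_iff: "c * p + d * r = 0 \<longleftrightarrow> complex_of_int c * of_int p + of_int d * of_int r = 0"
    by (simp flip: of_int_mult of_int_add)
  have 3: "moebius (A ** B) P = pt (of_int a * u + of_int b * v) (of_int c * u + of_int d * v)"
    by (cases P)
       (simp_all add: moebius_def pt_def u_def v_def matrix_mult_2 int_iff algebra_simps
                 flip: a_def b_def c_def d_def p_def q_def r_def s_def)
  show ?thesis by (simp add: 1 2 3)
qed

lemma moebius_extended_half_plane:
  assumes "det M > 0" "P \<in> extended_half_plane"
  shows "moebius M P \<in> extended_half_plane"
proof -
  consider z where "P = Fin z" "Im z > 0" | z where "P = Fin z" "z \<in> \<rat>" | "P = Infty"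
    using assms(2) by (auto simp: extended_half_plane_def upper_half_plane_def)
  then show ?thesis
  proof cases
    case (1 z)
    define a b c d where "a = real_of_int (M$1$1)" and "b = real_of_int (M$1$2)"
      and "c = real_of_int (M$2$1)" and "d = real_of_int (M$2$2)"
    have det: "a * d - b * c > 0"
      using assms(1) unfolding det_2 a_def b_def c_def d_def
      by (metis of_int_0_less_iff of_int_diff of_int_mult)
    let ?w = "of_real c * z + of_real d"
    have nz: "?w \<noteq> 0"
    proof
      assume "?w = 0"
      then have "c * Im z = 0" "c * Re z + d = 0" by (auto simp: complex_eq_iff)
      then show False using det 1 by auto
    qed
    have "Im ((of_real a * z + of_real b) / ?w) = (a * d - b * c) * Im z / ((Re ?w)^2 + (Im ?w)^2)"
      by (simp add: Im_divide algebra_simps)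
    moreover have "(Re ?w)^2 + (Im ?w)^2 > 0"
      using nz by (metis complex_neq_0)
    ultimately have "Im ((of_real a * z + of_real b) / ?w) > 0"
      using det 1 by simp
    then show ?thesis using nz 1
      by (simp add: moebius_def extended_half_plane_def upper_half_plane_def
                    a_def b_def c_def d_def)
  qed (auto simp: moebius_def extended_half_plane_def)
qed

lemma det_mat2: "det (mat2 p q r s) = p * s - q * r"
  by (simp add: det_2)

lemma mat2_eta: "M = mat2 (M$1$1) (M$1$2) (M$2$1) (M$2$2)"
  by (simp add: vec_eq_iff forall_2)

lemma mat2_mult:
  "mat2 a b c d ** mat2 p q r s
     = mat2 (a * p + b * r) (a * q + b * s) (c * p + d * r) (c * q + d * s)"
  by (simp add: vec_eq_iff forall_2 matrix_mult_2)

lemma moebius_scalar: "k \<noteq> 0 \<Longrightarrow> moebius (mat2 k 0 0 k) P = P"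
  by (cases P) (simp_all add: moebius_def)

lemma equiv_Gamma0_rel: "equiv extended_half_plane (Gamma0_rel N)"
proof (rule equivI)
  show "Gamma0_rel N \<subseteq> extended_half_plane \<times> extended_half_plane"
    by (auto simp: Gamma0_rel_def)
  show "refl_on extended_half_plane (Gamma0_rel N)"
  proof (rule refl_onI)
    fix P assume "P \<in> extended_half_plane"
    moreover have "mat2 1 0 0 1 \<in> Gamma0 N"
      by (simp add: Gamma0_def SL2Z_def det_mat2)
    ultimately show "(P, P) \<in> Gamma0_rel N"
      unfolding Gamma0_rel_def using moebius_scalar[of 1 P] by force
  qed
  show "sym (Gamma0_rel N)"
  proof (rule symI)
    fix P Q assume "(P, Q) \<in> Gamma0_rel N"
    then obtain M where M: "M \<in> Gamma0 N" "Q = moebius M P"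
      and PQ: "P \<in> extended_half_plane" "Q \<in> extended_half_plane"
      by (auto simp: Gamma0_rel_def)
    define M' where "M' = mat2 (M$2$2) (- M$1$2) (- M$2$1) (M$1$1)"
    have det: "det M = 1" "M$1$1 * M$2$2 - M$1$2 * M$2$1 = 1"
      using M by (simp_all add: Gamma0_def SL2Z_def det_2)
    have det': "det M' = 1" unfolding M'_def det_mat2 using det by (simp add: algebra_simps)
    have M': "M' \<in> Gamma0 N"
      using M det' by (simp add: Gamma0_def SL2Z_def M'_def)
    have "M' ** M = mat2 1 0 0 1"
      using det by (simp add: vec_eq_iff forall_2 matrix_mult_2 M'_def algebra_simps)
    then have "moebius M' Q = P"
      using moebius_mult[of M' M P] det det' M moebius_scalar[of 1 P] by simp
    then show "(Q, P) \<in> Gamma0_rel N"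
      using M' PQ by (auto simp: Gamma0_rel_def)
  qed
  show "trans (Gamma0_rel N)"
  proof (rule transI)
    fix P Q R assume "(P, Q) \<in> Gamma0_rel N" "(Q, R) \<in> Gamma0_rel N"
    then obtain A B where A: "A \<in> Gamma0 N" "Q = moebius A P" and B: "B \<in> Gamma0 N" "R = moebius B Q"
      and PR: "P \<in> extended_half_plane" "R \<in> extended_half_plane"
      by (auto simp: Gamma0_rel_def)
    have "B ** A \<in> Gamma0 N"
      using A B by (simp add: Gamma0_def SL2Z_def det_mul matrix_mult_2)
    moreover have "R = moebius (B ** A) P"
      using A B moebius_mult[of B A P] by (simp add: Gamma0_def SL2Z_def)
    ultimately show "(P, R) \<in> Gamma0_rel N"
      using PR by (auto simp: Gamma0_rel_def)
  qed
qed

lemma orbit_eq: "P \<in> extended_half_plane \<Longrightarrow> orbit N P = (\<lambda>M. moebius M P) ` Gamma0 N"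
  using moebius_extended_half_plane[of _ P]
  by (auto simp: orbit_def Gamma0_rel_def Gamma0_def SL2Z_def)

lemma atkin_lehner_orbit:
  assumes N: "N > 0" and P: "P \<in> extended_half_plane"
  shows "atkin_lehner N (orbit N P) = orbit N (moebius (fricke N) P)"
proof -
  have detW: "det (fricke N) = N" by (simp add: fricke_def det_mat2)
  have WP: "moebius (fricke N) P \<in> extended_half_plane"
    using moebius_extended_half_plane[of "fricke N" P] detW N P by simp
  have swap: "\<exists>M'\<in>Gamma0 N. M' ** fricke N = fricke N ** M \<and> M ** fricke N = fricke N ** M'"
    if M: "M \<in> Gamma0 N" for M
  proof -
    obtain k where k: "M$2$1 = N * k" using M by (auto simp: Gamma0_def)
    let ?M' = "mat2 (M$2$2) (- k) (- N * M$1$2) (M$1$1)"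
    have "det ?M' = 1"
      using M k unfolding det_mat2 by (simp add: Gamma0_def SL2Z_def det_2 algebra_simps)
    then have "?M' \<in> Gamma0 N" by (simp add: Gamma0_def SL2Z_def)
    moreover have "?M' ** fricke N = fricke N ** M" "M ** fricke N = fricke N ** ?M'"
      using k by (simp_all add: vec_eq_iff forall_2 matrix_mult_2 fricke_def)
    ultimately show ?thesis by blast
  qed
  have comm: "moebius M' (moebius (fricke N) P) = moebius (fricke N) (moebius M P)"
    if "M \<in> Gamma0 N" "M' \<in> Gamma0 N" "M' ** fricke N = fricke N ** M" for M M'
    using that N detW moebius_mult[of M' "fricke N" P] moebius_mult[of "fricke N" M P]
    by (simp add: Gamma0_def SL2Z_def)
  show ?thesis
    unfolding orbit_eq[OF P] orbit_eq[OF WP] atkin_lehner_def image_image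
  proof (intro equalityI subsetI; elim imageE)
    fix R M assume "R = moebius (fricke N) (moebius M P)" "M \<in> Gamma0 N"
    then show "R \<in> (\<lambda>M. moebius M (moebius (fricke N) P)) ` Gamma0 N"
      using swap[of M] comm[of M] by force
  next
    fix R M assume "R = moebius M (moebius (fricke N) P)" "M \<in> Gamma0 N"
    then show "R \<in> (\<lambda>M. moebius (fricke N) (moebius M P)) ` Gamma0 N"
      using swap[of M] comm[of _ M] by force
  qed
qed

section \<open>The procedure\<close>

definition step1 :: "int \<Rightarrow> int \<times> int \<Rightarrow> bool" where
  "step1 N = (\<lambda>(d, \<beta>). (d, \<beta>) = (4 * N, 0) \<or> ([N = 3] (mod 4) \<and> (d, \<beta>) = (N, N)))"

definition initial_form :: "int \<Rightarrow> bqf \<Rightarrow> bool" where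
  "initial_form d Q \<longleftrightarrow> bqf_reduced Q \<and> bqf_disc Q = - d"

definition step2 :: "int \<Rightarrow> bqf \<Rightarrow> bqf \<Rightarrow> bool" where
  "step2 N Q F \<longleftrightarrow> bqf_equiv Q F \<and> gcd (cA F) N = 1"

definition step3_solution :: "int \<Rightarrow> int \<Rightarrow> bqf \<Rightarrow> int \<Rightarrow> bool" where
  "step3_solution N \<beta> F K \<longleftrightarrow> [2 * cA F * K + cB F = - \<beta>] (mod (2 * N))"

definition step3_form :: "bqf \<Rightarrow> int \<Rightarrow> bqf" where
  "step3_form F K = bqf_comp F (mat2 K (-1) 1 0)"

text \<open>The principal branch \<open>csqrt\<close> takes the value $i\sqrt d$ at $-d$ for $d > 0$.\<close>

definition step4 :: "int \<Rightarrow> bqf \<Rightarrow> complex" where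
  "step4 d G = (- of_int (cB G) + csqrt (of_int (- d))) / (2 * of_int (cA G))"

text \<open>\<open>outcome N d \<beta> Q \<tau>\<close>: the procedure, run with the choices \<open>(d, \<beta>)\<close> and \<open>Q\<close> and with some
  admissible choices of \<open>[a,b,c]\<close> and \<open>K\<close>, may return \<open>\<tau>\<close>.\<close>

definition outcome :: "int \<Rightarrow> int \<times> int \<Rightarrow> bqf \<Rightarrow> complex \<Rightarrow> bool" where
  "outcome N = (\<lambda>(d, \<beta>) Q \<tau>. step1 N (d, \<beta>) \<and> initial_form d Q \<and>
     (\<exists>F K. step2 N Q F \<and> step3_solution N \<beta> F K \<and> \<tau> = step4 d (step3_form F K)))"

end

theory Submission
  imports Defs
begin

text \<open>Everything rests on the correspondence between primitive positive definite forms
  \<open>G = [A,B,C]\<close> and their roots \<open>\<tau>\<close> in the upper half plane, the solutions of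
  \<open>A\<tau>\<^sup>2 + B\<tau> + C = 0\<close>.

  \<^item> \<^bold>\<open>Step 2.\<close> A primitive form \<open>F\<close> takes a value prime to \<open>N\<close>: modulo a prime \<open>p\<close> one of
    \<open>F(1,0)\<close>, \<open>F(0,1)\<close>, \<open>F(1,1)\<close> is nonzero, and these local choices are glued by taking for \<open>x\<close>
    and \<open>y\<close> suitable products of primes dividing \<open>N\<close> (\<open>coprime_value\<close>). After division of \<open>(x,y)\<close>
    by its gcd, a unimodular matrix with first column \<open>(x,y)\<close> makes the value a leading
    coefficient.

  \<^item> \<^bold>\<open>Step 3.\<close> The congruence is solvable because \<open>b \<equiv> d \<equiv> \<beta> (mod 2)\<close>, and it says
    \<open>B \<equiv> \<beta> (mod 2N)\<close>. As \<open>\<beta>\<^sup>2 \<equiv> -d (mod 4N)\<close> and \<open>C = a\<close> is prime to \<open>N\<close>, the identity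
    \<open>4AC = B\<^sup>2 + d\<close> gives \<open>N | A\<close> (\<open>step3_congruences\<close>).

  \<^item> \<^bold>\<open>Fixed point.\<close> Let \<open>e = 1\<close> if \<open>d = 4N\<close> and \<open>e = 2\<close> if \<open>d = N\<close>, so that \<open>e\<^sup>2d = 4N\<close>. The integral
    matrix with rows \<open>(-eB/2, -eC)\<close> and \<open>(eA, eB/2)\<close> fixes \<open>\<tau>\<close> and has determinant \<open>N\<close>; the
    congruences for \<open>A\<close> and \<open>B\<close> make it the product of an element of \<open>\<Gamma>\<^sub>0(N)\<close> and
    the matrix of \<open>\<tau> \<mapsto> -1/(N\<tau>)\<close> (\<open>fricke_fixed\<close>).

  \<^item> \<^bold>\<open>Inequivalence.\<close> If \<open>\<tau>' = M\<tau>\<close> with \<open>M\<close> unimodular, then \<open>G' \<circ> M\<close> and \<open>G\<close> are primitive positive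
    definite forms with the same root, hence equal (\<open>root_determines_form\<close>). Therefore \<open>d = d'\<close>,
    which determines \<open>\<beta>\<close>, and \<open>Q\<close> is equivalent to \<open>Q'\<close>. Two equivalent reduced forms are equal
    (\<open>reduced_unique\<close>).\<close>

section \<open>Equivalence of forms\<close>

lemma bqf_comp_mult: "bqf_comp F (A ** B) = bqf_comp (bqf_comp F A) B"
proof -
  have "bqf_eval (bqf_comp F (A ** B)) x y = bqf_eval (bqf_comp (bqf_comp F A) B) x y" for x y
    by (simp add: bqf_eval_comp matrix_mult_2 algebra_simps)
  then show ?thesis by (simp flip: bqf_eval_inject add: fun_eq_iff)
qed

lemma bqf_comp_id: "bqf_comp F (mat2 1 0 0 1) = F"
  by (cases F) (simp add: bqf_comp_def)

lemma bqf_equiv_sym: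
  assumes "bqf_equiv F G" shows "bqf_equiv G F"
proof -
  obtain M where M: "M \<in> SL2Z" "G = bqf_comp F M"
    using assms by (auto simp: bqf_equiv_def)
  define M' where "M' = mat2 (M$2$2) (- M$1$2) (- M$2$1) (M$1$1)"
  have det: "M$1$1 * M$2$2 - M$1$2 * M$2$1 = 1"
    using M by (simp add: SL2Z_def det_2)
  then have "M ** M' = mat2 1 0 0 1"
    by (simp add: vec_eq_iff forall_2 matrix_mult_2 M'_def algebra_simps)
  then have "bqf_comp G M' = F"
    by (simp add: M bqf_comp_id flip: bqf_comp_mult)
  moreover have "M' \<in> SL2Z"
    unfolding SL2Z_def M'_def using det by (simp add: det_mat2 algebra_simps)
  ultimately show ?thesis by (auto simp: bqf_equiv_def)
qed

lemma bqf_equiv_trans: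
  assumes "bqf_equiv F G" "bqf_equiv G H" shows "bqf_equiv F H"
proof -
  obtain A B where "A \<in> SL2Z" "G = bqf_comp F A" "B \<in> SL2Z" "H = bqf_comp G B"
    using assms by (auto simp: bqf_equiv_def)
  then have "H = bqf_comp F (A ** B)" "A ** B \<in> SL2Z"
    by (simp_all add: bqf_comp_mult SL2Z_def det_mul)
  then show ?thesis by (auto simp: bqf_equiv_def)
qed

lemma bqf_disc_equiv:
  assumes "bqf_equiv F G" shows "bqf_disc G = bqf_disc F"
proof -
  obtain M where M: "det M = 1" "G = bqf_comp F M"
    using assms by (auto simp: bqf_equiv_def SL2Z_def)
  have "bqf_disc G = (det M)^2 * bqf_disc F"
    unfolding M(2) det_2 bqf_disc_def bqf_comp_def Let_def bqf.sel
    by algebra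
  then show ?thesis using M by simp
qed

lemma bqf_primitive_equiv:
  assumes "bqf_equiv F G" "bqf_primitive F" shows "bqf_primitive G"
proof -
  obtain M where M: "F = bqf_comp G M"
    using bqf_equiv_sym[OF assms(1)] by (auto simp: bqf_equiv_def)
  define g where "g = gcd (cA G) (gcd (cB G) (cC G))"
  have "g dvd cA G" "g dvd cB G" "g dvd cC G"
    unfolding g_def using dvd_trans by (auto intro: gcd_dvd1 gcd_dvd2)
  then have "g dvd cA F" "g dvd cB F" "g dvd cC F"
    by (auto simp: M bqf_comp_def Let_def intro!: dvd_add)
  then have "g dvd 1"
    using assms(2) unfolding bqf_primitive_def by (metis gcd_greatest)
  then show ?thesis unfolding bqf_primitive_def g_def by simp
qed

lemma bqf_pos_def_equiv:
  assumes "bqf_equiv F G" "bqf_pos_def F" shows "bqf_pos_def G"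
proof -
  obtain M where M: "M \<in> SL2Z" "G = bqf_comp F M"
    using assms(1) by (auto simp: bqf_equiv_def)
  have det: "M$1$1 * M$2$2 - M$1$2 * M$2$1 = 1"
    using M by (simp add: SL2Z_def det_2)
  have "(M$1$1 * x + M$1$2 * y, M$2$1 * x + M$2$2 * y) \<noteq> (0, 0)" if "(x, y) \<noteq> (0, 0)" for x y
  proof
    assume *: "(M$1$1 * x + M$1$2 * y, M$2$1 * x + M$2$2 * y) = (0, 0)"
    have "(M$1$1 * M$2$2 - M$1$2 * M$2$1) * x = 0" "(M$1$1 * M$2$2 - M$1$2 * M$2$1) * y = 0"
      using * by (simp_all, algebra+)
    then show False using that det by simp
  qed
  then show ?thesis
    using assms(2) by (auto simp: bqf_pos_def_def M bqf_eval_comp)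
qed

lemma bqf_pos_def_cA: "bqf_pos_def F \<Longrightarrow> cA F > 0"
  unfolding bqf_pos_def_def by (drule spec[of _ 1], drule spec[of _ 0]) (simp add: bqf_eval_def)

section \<open>Uniqueness of the reduced form in a class\<close>

text \<open>Let \<open>(p,r)\<close> be the first column of the matrix taking \<open>Q\<close> to \<open>Q'\<close>. For the reduced form
  \<open>Q = [a,b,c]\<close> the bounds \<open>\<bar>b\<bar> \<le> a \<le> c\<close> give \<open>a' = Q(p,r) \<ge> a(p\<^sup>2 - \<bar>pr\<bar> + r\<^sup>2) \<ge> a\<close>. Hence \<open>a' \<le> a\<close>
  forces equality throughout, and \<open>(p,r)\<close> is one of \<open>(\<plusminus>1,0)\<close>, \<open>(0,\<plusminus>1)\<close>, \<open>(\<plusminus>1,\<plusminus>1)\<close>, where the last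
  two require \<open>a = c\<close> and \<open>\<bar>b\<bar> = a = c\<close>. The sign convention for reduced forms settles what
  remains; since the discriminants agree, it is enough to show \<open>b = b'\<close>. The assumption
  \<open>a' \<le> a\<close> costs nothing, as equivalence is symmetric.\<close>

lemma reduced_unique_aux:
  assumes red: "bqf_reduced Q" "bqf_reduced Q'" and eq: "bqf_equiv Q Q'" and le: "cA Q' \<le> cA Q"
  shows "Q = Q'"
proof -
  obtain M where M: "M \<in> SL2Z" "Q' = bqf_comp Q M"
    using eq by (auto simp: bqf_equiv_def)
  define p q r s where "p = M$1$1" and "q = M$1$2" and "r = M$2$1" and "s = M$2$2"
  define a b c where "a = cA Q" and "b = cB Q" and "c = cC Q"
  define a' b' c' where "a' = cA Q'" and "b' = cB Q'" and "c' = cC Q'"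
  have det: "p * s - q * r = 1"
    using M by (simp add: SL2Z_def det_2 p_def q_def r_def s_def)
  have R: "\<bar>b\<bar> \<le> a" "a \<le> c" "\<bar>b\<bar> = a \<or> a = c \<Longrightarrow> b \<ge> 0" "a > 0"
    using red(1) bqf_pos_def_cA[of Q] by (auto simp: bqf_reduced_def a_def b_def c_def)
  have R': "\<bar>b'\<bar> \<le> a'" "a' \<le> c'" "\<bar>b'\<bar> = a' \<or> a' = c' \<Longrightarrow> b' \<ge> 0" "a' > 0"
    using red(2) bqf_pos_def_cA[of Q'] by (auto simp: bqf_reduced_def a'_def b'_def c'_def)
  have a': "a' = a * p^2 + b * p * r + c * r^2"
    and b': "b' = 2 * a * p * q + b * (p * s + q * r) + 2 * c * r * s"
    by (simp_all add: a'_def b'_def M bqf_comp_def Let_def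
          a_def b_def c_def p_def q_def r_def s_def)
  have disc: "b'^2 - 4 * a' * c' = b^2 - 4 * a * c"
    using bqf_disc_equiv[OF eq]
    by (simp add: bqf_disc_def a_def b_def c_def a'_def b'_def c'_def)

  define m where "m = p^2 - \<bar>p * r\<bar> + r^2"
  have m2: "2 * m = p^2 + r^2 + (\<bar>p\<bar> - \<bar>r\<bar>)^2"
    by (simp add: m_def power2_eq_square abs_mult algebra_simps)
  have "p \<noteq> 0 \<or> r \<noteq> 0" using det by auto
  then have "p^2 + r^2 > 0" by (simp add: sum_power2_gt_zero_iff)
  then have m_pos: "m \<ge> 1" using m2 zero_le_power2[of "\<bar>p\<bar> - \<bar>r\<bar>"] by linarith
  have "\<bar>b * (p * r)\<bar> \<le> a * \<bar>p * r\<bar>"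
    using R(1) by (simp add: abs_mult mult_right_mono)
  moreover have "c * r^2 \<ge> a * r^2" using R(2) by (simp add: mult_right_mono)
  ultimately have am: "a * m \<le> a'"
    by (simp add: a' m_def algebra_simps abs_le_iff)
  have "a * m \<le> a * 1" using am le by (simp add: a_def a'_def)
  then have m1: "m = 1" using m_pos R(4) by simp
  have aa: "a' = a" using am m1 le by (simp add: a_def a'_def)

  have bb_imp: "Q = Q'" if "b = b'"
  proof -
    have "c = c'" using disc that aa R(4) by simp
    then show ?thesis using that aa
      by (cases Q; cases Q') (simp add: a_def b_def c_def a'_def b'_def c'_def)
  qed
  have small: "\<bar>p\<bar> \<le> 1" "\<bar>r\<bar> \<le> 1"
  proof -
    have "4 * m = (2 * \<bar>p\<bar> - \<bar>r\<bar>)^2 + 3 * r^2" "4 * m = (2 * \<bar>r\<bar> - \<bar>p\<bar>)^2 + 3 * p^2"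
      by (simp_all add: m_def power2_eq_square abs_mult algebra_simps)
    then obtain u v where "4 = u^2 + 3 * r^2" "4 = v^2 + 3 * p^2" using m1 by auto
    then have "3 * r^2 \<le> 4" "3 * p^2 \<le> 4"
      using zero_le_power2[of u] zero_le_power2[of v] by - linarith+
    then have "\<bar>p\<bar>^2 < 2^2" "\<bar>r\<bar>^2 < 2^2" by simp_all
    then have "\<bar>p\<bar> < 2" "\<bar>r\<bar> < 2"
      using power2_less_imp_less[of "\<bar>p\<bar>" 2] power2_less_imp_less[of "\<bar>r\<bar>" 2] by simp_all
    then show "\<bar>p\<bar> \<le> 1" "\<bar>r\<bar> \<le> 1" by simp_all
  qed
  \<comment> \<open>The middle coefficients turn out to agree up to sign modulo \<open>2a\<close>, and the interval \<open>[-a,a]\<close>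
      that contains them is one period long with only its endpoints identified.\<close>
  have endpoints: "x = y \<or> \<bar>x\<bar> = a \<and> \<bar>y\<bar> = a"
    if "y = x + 2 * a * k" "\<bar>x\<bar> \<le> a" "\<bar>y\<bar> \<le> a" for x y k :: int
  proof -
    consider "k = 0" | "k \<ge> 1" | "k \<le> -1" by linarith
    then show ?thesis
    proof cases
      case 2
      then have "a * k \<ge> a * 1" using R(4) by (intro mult_left_mono) auto
      then show ?thesis using that by auto
    next
      case 3
      then have "a * k \<le> a * (-1)" using R(4) by (intro mult_left_mono) auto
      then show ?thesis using that by auto
    qed (use that in auto)
  qed
  have bound': "\<bar>b'\<bar> \<le> a" using R'(1) aa by simp
  have b_a: "b = a" if "\<bar>b\<bar> = a" using R(3) that by linarith
  have b'_a: "b' = a" if "\<bar>b'\<bar> = a" using R'(3) that aa by linarith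
  consider "r = 0" | "p = 0" | "p \<noteq> 0" "r \<noteq> 0" by blast
  then show ?thesis
  proof cases
    case 1
    then have ps: "p * s = 1" using det by simp
    then have "b' = b + 2 * a * (p * q)" using b' 1 by simp
    from endpoints[OF this R(1) bound'] have "b = b'" using b_a b'_a by metis
    then show ?thesis by (rule bb_imp)
  next
    case 2
    then have qr: "q * r = -1" using det by simp
    then have "r \<noteq> 0" by auto
    then have "r = 1 \<or> r = -1" using small(2) by linarith
    then have "r^2 = 1" by auto
    then have ca: "c = a" using a' aa 2 by simp
    then have b0: "b \<ge> 0" using R(3) by simp
    have "b' = - b + 2 * a * (r * s)" using b' 2 qr ca by (simp add: algebra_simps)
    from endpoints[OF this _ bound'] have "- b = b' \<or> \<bar>b\<bar> = a \<and> \<bar>b'\<bar> = a"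
      using R(1) by simp
    then show ?thesis
    proof
      assume b': "- b = b'"
      then have "a * c' = a * c" using disc aa by (simp flip: b')
      then have "c' = a'" using ca aa R(4) by simp
      then have "b' \<ge> 0" using R'(3) by simp
      then have "b = b'" using b' b0 by simp
      then show ?thesis by (rule bb_imp)
    next
      assume "\<bar>b\<bar> = a \<and> \<bar>b'\<bar> = a"
      then have "b = b'" using b_a b'_a by metis
      then show ?thesis by (rule bb_imp)
    qed
  next
    case 3
    then have "p = 1 \<or> p = -1" "r = 1 \<or> r = -1" using small by linarith+
    then have pr: "p^2 = 1" "r^2 = 1" "p * r = 1 \<or> p * r = -1" by auto
    have "b * (p * r) + c = 0" using a' aa pr(1,2) by (simp add: algebra_simps)
    then have "c = - b \<or> c = b" using pr(3) by auto
    then have b: "b = a" "c = a" using R by linarith+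
    have "b'^2 = a * (4 * c') - 3 * a^2" using disc aa b by (simp add: power2_eq_square)
    moreover have "a * (4 * c') \<ge> a * (4 * a)" using R'(2) aa R(4) by simp
    ultimately have "a^2 \<le> b'^2" by (simp add: power2_eq_square)
    then have "\<bar>a\<bar> \<le> \<bar>b'\<bar>" by (simp add: abs_le_square_iff)
    then have "\<bar>b'\<bar> = a" using bound' by linarith
    then show ?thesis using bb_imp b'_a b by metis
  qed
qed

lemma reduced_unique:
  assumes "bqf_reduced Q" "bqf_reduced Q'" "bqf_equiv Q Q'"
  shows "Q = Q'"
  using reduced_unique_aux[of Q Q'] reduced_unique_aux[of Q' Q] assms bqf_equiv_sym[of Q Q']
  by (metis linear)

section \<open>Values prime to a given integer\<close>

text \<open>If \<open>p\<close> does not divide \<open>a\<close>, it suffices that \<open>p | y\<close> but not \<open>p | x\<close>; if \<open>p\<close> divides \<open>a\<close> but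
  not \<open>c\<close>, the roles of \<open>x\<close> and \<open>y\<close> are exchanged; if \<open>p\<close> divides \<open>a\<close> and \<open>c\<close>, then it does not
  divide \<open>b\<close>, and \<open>x\<close> and \<open>y\<close> have to be prime to \<open>p\<close>. Products of the primes in question meet all
  these requirements at once, without the Chinese remainder theorem.\<close>

lemma coprime_value:
  assumes prim: "bqf_primitive F" and N: "N \<noteq> 0"
  obtains x y where "coprime (bqf_eval F x y) N"
proof -
  define a b c where "a = cA F" and "b = cB F" and "c = cC F"
  define S where "S = prime_factors N"
  have fin: "finite S" by (simp add: S_def)
  have pr: "prime p" if "p \<in> S" for p using that by (auto simp: S_def)
  define x where "x = \<Prod>{p \<in> S. p dvd a \<and> \<not> p dvd c}"
  define y where "y = \<Prod>{p \<in> S. \<not> p dvd a}"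
  have dvd_iff: "p dvd \<Prod>{q \<in> S. P q} \<longleftrightarrow> P p" if p: "p \<in> S" for p P
  proof
    assume "P p"
    then show "p dvd \<Prod>{q \<in> S. P q}"
      using p fin by (intro dvd_prodI) auto
  next
    assume "p dvd \<Prod>{q \<in> S. P q}"
    then obtain q where "q \<in> S" "P q" "p dvd q"
      using prime_dvd_prod_iff[of "{q \<in> S. P q}" p "\<lambda>q. q"] fin pr[OF p] by auto
    then show "P p" using primes_dvd_imp_eq[of p q] pr p by auto
  qed
  have x: "p dvd x \<longleftrightarrow> p dvd a \<and> \<not> p dvd c" and y: "p dvd y \<longleftrightarrow> \<not> p dvd a" if "p \<in> S" for p
    using dvd_iff[OF that] unfolding x_def y_def by auto
  have not_dvd: "\<not> p dvd bqf_eval F x y" if p: "p \<in> S" for p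
  proof
    assume dvd: "p dvd bqf_eval F x y"
    have ev: "bqf_eval F x y = a * x * x + b * x * y + c * y * y"
      by (simp add: bqf_eval_def a_def b_def c_def power2_eq_square mult.assoc)
    note mult_iff = prime_dvd_mult_iff[OF pr[OF p]]
    consider "\<not> p dvd a" | "p dvd a" "\<not> p dvd c" | "p dvd a" "p dvd c" by blast
    then show False
    proof cases
      case 1
      then have "p dvd a * x * x"
        using dvd y[OF p] by (simp add: ev add.assoc dvd_add_left_iff)
      then show False using 1 x[OF p] by (simp add: mult_iff)
    next
      case 2
      then have "p dvd c * y * y"
        using dvd x[OF p] by (simp add: ev dvd_add_right_iff)
      then show False using 2 y[OF p] by (simp add: mult_iff)
    next
      case 3
      then have "p dvd b * x * y"
        using dvd by (simp add: ev dvd_add_left_iff dvd_add_right_iff)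
      then have "p dvd b" using 3 x[OF p] y[OF p] by (simp add: mult_iff)
      then have "p dvd gcd a (gcd b c)" using 3 by simp
      also have "gcd a (gcd b c) = 1" using prim by (simp add: bqf_primitive_def a_def b_def c_def)
      finally have "p dvd 1" .
      then show False using pr[OF p] by auto
    qed
  qed
  have "coprime (bqf_eval F x y) N"
  proof (rule ccontr)
    assume "\<not> coprime (bqf_eval F x y) N"
    then have "\<not> is_unit (gcd (bqf_eval F x y) N)" by (simp add: coprime_iff_gcd_eq_1)
    then obtain p where "prime p" "p dvd gcd (bqf_eval F x y) N"
      using prime_divisorE[of "gcd (bqf_eval F x y) N"] N by auto
    then show False using not_dvd[of p] N by (auto simp: S_def prime_factors_dvd)
  qed
  then show ?thesis by (rule that)
qed

lemma equiv_coprime_leading: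
  assumes prim: "bqf_primitive F" and N: "N > 1"
  shows "\<exists>G. bqf_equiv F G \<and> gcd (cA G) N = 1"
proof -
  obtain x y where xy: "coprime (bqf_eval F x y) N"
    using coprime_value[OF prim] N by (metis not_one_less_zero)
  have "(x, y) \<noteq> (0, 0)" using xy N by (auto simp: bqf_eval_def)
  then obtain x' y' where g: "x = x' * gcd x y" "y = y' * gcd x y" "coprime x' y'"
    by (metis gcd_coprime_exists gcd_eq_0_iff)
  have "bqf_eval F (x' * k) (y' * k) = k^2 * bqf_eval F x' y'" for k
    by (simp add: bqf_eval_def power2_eq_square algebra_simps)
  then have "bqf_eval F x y = (gcd x y)^2 * bqf_eval F x' y'"
    using g by metis
  then have cop: "coprime (bqf_eval F x' y') N" using xy by simp
  obtain u v where uv: "u * x' + v * y' = 1"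
    using bezout_int[of x' y'] g(3) by (auto simp: coprime_iff_gcd_eq_1)
  let ?M = "mat2 x' (- v) y' u"
  have "?M \<in> SL2Z" using uv by (simp add: SL2Z_def det_mat2 algebra_simps)
  moreover have "cA (bqf_comp F ?M) = bqf_eval F x' y'"
    by (simp add: bqf_comp_def Let_def bqf_eval_def)
  ultimately show ?thesis
    using cop by (auto simp: bqf_equiv_def coprime_iff_gcd_eq_1)
qed

section \<open>Roots in the upper half plane\<close>

definition bqf_at :: "bqf \<Rightarrow> complex \<Rightarrow> complex" where
  "bqf_at F z = of_int (cA F) * z^2 + of_int (cB F) * z + of_int (cC F)"

lemma bqf_at_comp:
  assumes "of_int (M$2$1) * z + of_int (M$2$2) \<noteq> 0"
    and "w = (of_int (M$1$1) * z + of_int (M$1$2)) / (of_int (M$2$1) * z + of_int (M$2$2))"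
  shows "bqf_at (bqf_comp F M) z = (of_int (M$2$1) * z + of_int (M$2$2))^2 * bqf_at F w"
proof -
  define v where "v = of_int (M$2$1) * z + of_int (M$2$2)"
  have wv: "w * v = of_int (M$1$1) * z + of_int (M$1$2)"
    using assms by (simp add: v_def)
  have "v^2 * bqf_at F w = of_int (cA F) * (w * v)^2 + of_int (cB F) * (w * v) * v + of_int (cC F) * v^2"
    by (simp add: bqf_at_def power2_eq_square algebra_simps)
  also have "\<dots> = bqf_at (bqf_comp F M) z"
    unfolding wv by (simp add: v_def bqf_at_def bqf_comp_def Let_def power2_eq_square algebra_simps)
  finally show ?thesis by (simp add: v_def)
qed

text \<open>Eliminating \<open>z\<^sup>2\<close> from the two quadratic equations leaves a real linear equation with a
  nonreal solution, so the two forms are proportional; primitive forms with positive leading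
  coefficients are proportional only if they are equal.\<close>

lemma root_determines_form:
  assumes prim: "bqf_primitive F" "bqf_primitive G" and pos: "cA F > 0" "cA G > 0"
    and root: "bqf_at F z = 0" "bqf_at G z = 0" and z: "Im z \<noteq> 0"
  shows "F = G"
proof -
  define u v where "u = cA F * cB G - cA G * cB F" and "v = cA F * cC G - cA G * cC F"
  have "of_int u * z + of_int v = of_int (cA F) * bqf_at G z - of_int (cA G) * bqf_at F z"
    by (simp add: u_def v_def bqf_at_def algebra_simps)
  then have lin: "of_int u * z + of_int v = 0" using root by simp
  then have "Im (of_int u * z + of_int v) = 0" by simp
  then have "u = 0" using z by simp
  moreover from this lin have "v = 0" by simp
  ultimately have proportional: "cA F * cB G = cA G * cB F" "cA F * cC G = cA G * cC F"
    by (simp_all add: u_def v_def)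
  have dvd: "cA F dvd cA G"
    if "bqf_primitive F" "cA F * cB G = cA G * cB F" "cA F * cC G = cA G * cC F"
      "cA G > 0" for F G
  proof -
    have "cA F dvd cA G * cA F" "cA F dvd cA G * cB F" "cA F dvd cA G * cC F"
      using that(2,3) by (simp_all flip: that(2,3))
    then have "cA F dvd gcd (cA G * cA F) (gcd (cA G * cB F) (cA G * cC F))" by simp
    also have "\<dots> = cA G"
      using that(1,4) by (simp add: gcd_mult_left abs_mult bqf_primitive_def)
    finally show ?thesis .
  qed
  have "cA F dvd cA G" "cA G dvd cA F"
    using dvd[of F G] dvd[of G F] prim proportional pos by simp_all
  then have "cA F = cA G" using pos by (simp add: zdvd_antisym_nonneg)
  then show ?thesis using proportional pos by (cases F; cases G) simp
qed

lemma step4_root: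
  assumes "cA G > 0" "bqf_disc G = - d" "d > 0"
  shows "Im (step4 d G) > 0" "bqf_at G (step4 d G) = 0"
proof -
  define t where "t = step4 d G"
  define w where "w = csqrt (of_int (- d))"
  have w: "w = \<i> * of_real (sqrt (of_int d))"
    using assms(3) csqrt_of_real_nonpos[of "- of_int d"] by (simp add: w_def)
  have w2: "w^2 = of_int (- d)" by (simp add: w_def)
  have t: "t = (- of_int (cB G) + w) / of_int (2 * cA G)" by (simp add: t_def step4_def w_def)
  then have "t = (- of_int (cB G) + w) / of_real (of_int (2 * cA G))" by simp
  then have "Im t = sqrt (of_int d) / of_int (2 * cA G)"
    by (simp only: Im_divide_of_real) (simp add: w)
  then show "Im (step4 d G) > 0" using assms by (simp add: t_def)
  have "2 * of_int (cA G) * t + of_int (cB G) = w" using t assms(1) by simp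
  then have "(2 * of_int (cA G) * t + of_int (cB G))^2 = of_int (bqf_disc G)"
    using w2 assms(2) by simp
  then have "4 * of_int (cA G) * bqf_at G t = 0"
    by (simp add: bqf_at_def bqf_disc_def power2_eq_square algebra_simps)
  then show "bqf_at G (step4 d G) = 0" using assms(1) by (simp add: t_def)
qed

section \<open>The steps of the procedure\<close>

text \<open>The two choices of \<open>(d,\<beta>)\<close> enter the rest of the argument only through these properties; the
  witnesses for \<open>e\<close> are \<open>1\<close> for \<open>d = 4N\<close> and \<open>2\<close> for \<open>d = N\<close>. Where \<open>d = \<beta> = N\<close>, the first one
  reads \<open>4 | N + 1\<close>.\<close>

lemma step1_props:
  assumes "step1 N (d, \<beta>)" "N > 0"
  shows "4 * N dvd \<beta>^2 + d" "2 dvd d - \<beta>" "d > 0"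
    "\<exists>e. e^2 * d = 4 * N \<and> 2 * N dvd e * \<beta>"
proof -
  consider "d = 4 * N" "\<beta> = 0" | "[N = 3] (mod 4)" "d = N" "\<beta> = N"
    using assms(1) by (auto simp: step1_def)
  then have "4 * N dvd \<beta>^2 + d \<and> 2 dvd d - \<beta> \<and> d > 0 \<and>
      (\<exists>e. e^2 * d = 4 * N \<and> 2 * N dvd e * \<beta>)"
  proof cases
    case 1
    then show ?thesis using assms(2) by (auto intro!: exI[of _ 1])
  next
    case 2
    have "4 dvd N + 1" using 2(1) by (simp add: cong_def) presburger
    then have "N * 4 dvd N * (N + 1)" by (rule mult_dvd_mono[OF dvd_refl])
    then show ?thesis using assms(2) 2
      by (auto intro!: exI[of _ 2] simp: power2_eq_square algebra_simps)
  qed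
  then show "4 * N dvd \<beta>^2 + d" "2 dvd d - \<beta>" "d > 0"
    "\<exists>e. e^2 * d = 4 * N \<and> 2 * N dvd e * \<beta>" by auto
qed

lemma step2_props:
  assumes "initial_form d Q" "step2 N Q F"
  shows "bqf_primitive F" "bqf_pos_def F" "bqf_disc F = - d" "coprime (cA F) N"
  using assms bqf_primitive_equiv[of Q F] bqf_pos_def_equiv[of Q F] bqf_disc_equiv[of Q F]
  by (auto simp: initial_form_def bqf_reduced_def step2_def coprime_iff_gcd_eq_1)

lemma step3_solvable:
  assumes "step1 N (d, \<beta>)" "N > 0" "bqf_disc F = - d" "coprime (cA F) N"
  shows "\<exists>K. step3_solution N \<beta> F K"
proof -
  have "2 dvd (cB F)^2 + d"
    using assms(3) by (auto simp: bqf_disc_def algebra_simps)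
  then have "2 dvd cB F + \<beta>" using step1_props(2)[OF assms(1,2)] by auto
  then obtain h where h: "cB F + \<beta> = 2 * h" by (rule dvdE)
  obtain K where "[cA F * K = - h] (mod N)"
    using cong_solve_coprime_int[OF assms(4)] cong_scalar_right[of "_" 1 N "- h"]
    by (metis mult.assoc mult_1)
  then have "N dvd cA F * K + h" by (simp add: cong_iff_dvd_diff)
  then have "2 * N dvd 2 * (cA F * K + h)" by (rule mult_dvd_mono[OF dvd_refl])
  also have "2 * (cA F * K + h) = 2 * cA F * K + cB F - - \<beta>" using h by simp
  finally show ?thesis by (auto simp: step3_solution_def cong_iff_dvd_diff)
qed

lemma step3_equiv: "bqf_equiv F (step3_form F K)"
  unfolding bqf_equiv_def step3_form_def
  by (rule bexI[of _ "mat2 K (- 1) 1 0"]) (simp_all add: SL2Z_def det_mat2)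

text \<open>The last coefficient of the new form is \<open>a\<close>, prime to \<open>N\<close>, so that \<open>N\<close> divides the first
  coefficient as soon as it divides the product \<open>(B\<^sup>2 + d)/4\<close> of the two.\<close>

lemma step3_congruences:
  assumes s1: "step1 N (d, \<beta>)" and N: "N > 0" and disc: "bqf_disc F = - d"
    and cop: "coprime (cA F) N" and sol: "step3_solution N \<beta> F K"
  shows "N dvd cA (step3_form F K)" "[cB (step3_form F K) = \<beta>] (mod (2 * N))"
proof -
  define G where "G = step3_form F K"
  have B: "cB G = - (2 * cA F * K + cB F)" and C: "cC G = cA F"
    by (simp_all add: G_def step3_form_def bqf_comp_def Let_def)
  have "2 * N dvd - (2 * cA F * K + cB F + \<beta>)"
    using sol unfolding dvd_minus_iff by (simp add: step3_solution_def cong_iff_dvd_diff)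
  then have "2 * N dvd cB G - \<beta>" by (simp add: B)
  then show "[cB (step3_form F K) = \<beta>] (mod (2 * N))"
    by (simp add: cong_iff_dvd_diff G_def)
  obtain m where m: "cB G = \<beta> + 2 * N * m"
    using \<open>2 * N dvd cB G - \<beta>\<close> by (metis add.commute diff_add_cancel dvdE)
  have "4 * (cA F * cA G) = (cB G)^2 + d"
    using bqf_disc_equiv[OF step3_equiv[of F K]] disc
    by (simp add: bqf_disc_def[of G] C algebra_simps flip: G_def)
  also have "\<dots> = (\<beta>^2 + d) + 4 * N * (m * \<beta> + N * m^2)"
    by (simp add: m power2_eq_square algebra_simps)
  finally have "4 * N dvd 4 * (cA F * cA G)"
    using step1_props(1)[OF s1 N] by simp
  then have "N dvd cA F * cA G" by simp
  then show "N dvd cA (step3_form F K)"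
    using cop by (simp add: G_def coprime_dvd_mult_right_iff coprime_commute)
qed

section \<open>Fixed points of the involution\<close>

text \<open>The stabiliser of the root of \<open>[A,B,C]\<close> contains the matrix \<open>W\<close> of trace zero below. Its
  determinant is \<open>e\<^sup>2d/4 = N\<close>, and dividing \<open>W\<close> on the right by the matrix of the involution
  leaves the element \<open>M\<close> of \<open>\<Gamma>\<^sub>0(N)\<close>.\<close>

lemma fricke_fixed:
  assumes N: "N > 0" and e: "e^2 * d = 4 * N" and disc: "bqf_disc G = - d"
    and A: "N dvd cA G" "cA G > 0" and B: "2 * N dvd e * cB G"
    and z: "Im z > 0" "bqf_at G z = 0"
  shows "atkin_lehner N (orbit N (Fin z)) = orbit N (Fin z)"
proof -
  obtain k where k: "cA G = N * k" using A(1) by (rule dvdE)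
  obtain m where m: "e * cB G = 2 * N * m" using B by (rule dvdE)
  define M where "M = mat2 (e * cC G) (- m) (- N * m) (e * k)"
  define W where "W = mat2 (- N * m) (- e * cC G) (e * cA G) (N * m)"
  have e0: "e \<noteq> 0" using e N by auto
  have "(e * cB G)^2 - 4 * e^2 * cA G * cC G = - 4 * N"
    using disc e unfolding bqf_disc_def by algebra
  then have "4 * N * (e^2 * k * cC G - N * m^2) = 4 * N * 1"
    by (simp add: m k power2_eq_square algebra_simps)
  then have "e^2 * k * cC G - N * m^2 = 1" using N by simp
  then have "det M = 1" by (simp add: M_def det_mat2 power2_eq_square algebra_simps)
  then have M: "M \<in> Gamma0 N" by (simp add: Gamma0_def SL2Z_def M_def)
  have "M ** fricke N = W"
    by (simp add: M_def W_def fricke_def mat2_mult k algebra_simps)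
  then have MW: "moebius M (moebius (fricke N) (Fin z)) = moebius W (Fin z)"
    using moebius_mult[of M "fricke N" "Fin z"] \<open>det M = 1\<close> N
    by (simp add: fricke_def det_mat2)
  have "Im (of_int (e * cA G) * z + of_int (N * m)) \<noteq> 0"
    using e0 A z(1) by simp
  then have nz: "of_int (e * cA G) * z + of_int (N * m) \<noteq> 0" by (metis zero_complex.sel(2))
  have "2 * N * m = e * cB G" using m by simp
  then have mB: "2 * of_int N * of_int m = of_int e * (of_int (cB G) :: complex)"
    by (metis of_int_mult of_int_numeral)
  have "z * (of_int (e * cA G) * z + of_int (N * m)) - (of_int (- N * m) * z + of_int (- e * cC G))
        = of_int e * (of_int (cA G) * z^2 + of_int (cC G)) + (2 * of_int N * of_int m) * z"
    by (simp add: power2_eq_square algebra_simps)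
  also have "\<dots> = of_int e * bqf_at G z"
    unfolding mB by (simp add: bqf_at_def algebra_simps)
  finally have "z * (of_int (e * cA G) * z + of_int (N * m)) = of_int (- N * m) * z + of_int (- e * cC G)"
    using z(2) by simp
  then have "moebius W (Fin z) = Fin z"
    using nz by (simp add: moebius_def W_def nonzero_eq_divide_eq[symmetric] flip: of_int_mult)
  with MW have fixed: "Fin z = moebius M (moebius (fricke N) (Fin z))" by simp
  have zH: "Fin z \<in> extended_half_plane"
    using z by (simp add: extended_half_plane_def upper_half_plane_def)
  then have "moebius (fricke N) (Fin z) \<in> extended_half_plane"
    using N by (intro moebius_extended_half_plane) (simp_all add: fricke_def det_mat2)
  then have "(moebius (fricke N) (Fin z), Fin z) \<in> Gamma0_rel N"
    using fixed M zH by (auto simp: Gamma0_rel_def)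
  then have "orbit N (moebius (fricke N) (Fin z)) = orbit N (Fin z)"
    unfolding orbit_def by (rule equiv_class_eq[OF equiv_Gamma0_rel])
  then show ?thesis using atkin_lehner_orbit[OF N zH] by simp
qed

section \<open>Inequivalence of the fixed points\<close>

text \<open>If \<open>z' = Mz\<close>, then \<open>z\<close> is a root of \<open>G' \<circ> M\<close> as well as of \<open>G\<close>, so these forms coincide.\<close>

lemma related_roots_equiv:
  assumes prim: "bqf_primitive G" "bqf_primitive G'" and pos: "bqf_pos_def G" "bqf_pos_def G'"
    and root: "bqf_at G z = 0" "bqf_at G' z' = 0" and z: "Im z > 0"
    and rel: "(Fin z, Fin z') \<in> Gamma0_rel N"
  shows "bqf_equiv G' G"
proof -
  obtain M where M: "M \<in> SL2Z" "Fin z' = moebius M (Fin z)"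
    using rel by (auto simp: Gamma0_rel_def Gamma0_def)
  have eq: "bqf_equiv G' (bqf_comp G' M)" using M by (auto simp: bqf_equiv_def)
  have "bqf_at (bqf_comp G' M) z = 0"
    using M(2) bqf_at_comp[of M z z' G'] root(2) by (auto simp: moebius_def split: if_splits)
  then have "G = bqf_comp G' M"
    using root_determines_form[of G "bqf_comp G' M" z] prim pos root z
      bqf_primitive_equiv[OF eq] bqf_pos_def_equiv[OF eq] bqf_pos_def_cA by auto
  then show ?thesis using eq by simp
qed

lemma outcome_form:
  assumes "outcome N (d, \<beta>) Q t" "N > 0"
  obtains G where "bqf_equiv Q G" "bqf_primitive G" "bqf_pos_def G" "bqf_disc G = - d"
    "bqf_at G t = 0" "Im t > 0"
proof -
  obtain F K where s: "step1 N (d, \<beta>)" "initial_form d Q" "step2 N Q F"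
    and t: "t = step4 d (step3_form F K)"
    using assms(1) by (auto simp: outcome_def)
  have eq: "bqf_equiv Q (step3_form F K)"
    using s(3) step3_equiv bqf_equiv_trans by (auto simp: step2_def)
  have "bqf_primitive (step3_form F K)" "bqf_pos_def (step3_form F K)"
    "bqf_disc (step3_form F K) = - d"
    using s(2) bqf_primitive_equiv[OF eq] bqf_pos_def_equiv[OF eq] bqf_disc_equiv[OF eq]
    by (auto simp: initial_form_def bqf_reduced_def)
  then show ?thesis
    using that[OF eq] step4_root[of "step3_form F K" d] bqf_pos_def_cA step1_props(3)[OF s(1) assms(2)]
    by (simp add: t)
qed

theorem mainTheorem4:
  fixes N :: int
  assumes "N \<ge> 5"
  shows
    "(\<forall>d \<beta> Q. step1 N (d, \<beta>) \<and> initial_form d Q \<longrightarrow>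
        (\<exists>F. step2 N Q F) \<and>
        (\<forall>F. step2 N Q F \<longrightarrow>
          (\<exists>K. step3_solution N \<beta> F K) \<and>
          (\<forall>K G \<tau>. step3_solution N \<beta> F K \<and> G = step3_form F K \<and> \<tau> = step4 d G \<longrightarrow>
             N dvd cA G \<and> [cB G = \<beta>] (mod (2 * N)) \<and>
             \<tau> \<in> upper_half_plane \<and>
             orbit N (Fin \<tau>) \<in> X0 N \<and>
             atkin_lehner N (orbit N (Fin \<tau>)) = orbit N (Fin \<tau>)))) \<and>
     (\<forall>D Q \<tau> D' Q' \<tau>'. outcome N D Q \<tau> \<and> outcome N D' Q' \<tau>' \<and> (D, Q) \<noteq> (D', Q') \<longrightarrow>
        (Fin \<tau>, Fin \<tau>') \<notin> Gamma0_rel N)"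
proof -
  have N: "N > 0" "N > 1" using assms by simp_all
  have step2: "\<exists>F. step2 N Q F" if "initial_form d Q" for d Q
    using that equiv_coprime_leading[of Q N] N
    by (auto simp: initial_form_def bqf_reduced_def step2_def)
  have result: "N dvd cA G \<and> [cB G = \<beta>] (mod (2 * N)) \<and> \<tau> \<in> upper_half_plane \<and>
      orbit N (Fin \<tau>) \<in> X0 N \<and> atkin_lehner N (orbit N (Fin \<tau>)) = orbit N (Fin \<tau>)"
    if s: "step1 N (d, \<beta>)" "initial_form d Q" "step2 N Q F" "step3_solution N \<beta> F K"
      and G: "G = step3_form F K" and t: "\<tau> = step4 d G" for d \<beta> Q F K G \<tau>
  proof -
    note F = step2_props[OF s(2,3)]
    note cong = step3_congruences[OF s(1) N(1) F(3,4) s(4), folded G]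
    have eq: "bqf_equiv F G" using step3_equiv G by simp
    have posG: "cA G > 0" and discG: "bqf_disc G = - d"
      using bqf_pos_def_equiv[OF eq F(2)] bqf_pos_def_cA bqf_disc_equiv[OF eq] F(3) by auto
    have root: "Im \<tau> > 0" "bqf_at G \<tau> = 0"
      using step4_root[OF posG discG step1_props(3)[OF s(1) N(1)]] t by simp_all
    obtain e where e: "e^2 * d = 4 * N" "2 * N dvd e * \<beta>"
      using step1_props(4)[OF s(1) N(1)] by blast
    have "[e * cB G = e * \<beta>] (mod (2 * N))" using cong(2) by (rule cong_scalar_left)
    then have "2 * N dvd e * cB G" using e(2) cong_dvd_iff by (metis cong_0_iff cong_trans)
    then have "atkin_lehner N (orbit N (Fin \<tau>)) = orbit N (Fin \<tau>)"
      using fricke_fixed[OF N(1) e(1) discG cong(1) posG _ root] by simp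
    moreover have "orbit N (Fin \<tau>) \<in> X0 N"
      unfolding orbit_def X0_def using root(1)
      by (intro quotientI) (simp add: extended_half_plane_def upper_half_plane_def)
    ultimately show ?thesis using cong root by (simp add: upper_half_plane_def)
  qed
  have inequiv: "(D, Q) = (D', Q')"
    if o: "outcome N D Q \<tau>" "outcome N D' Q' \<tau>'" and rel: "(Fin \<tau>, Fin \<tau>') \<in> Gamma0_rel N"
    for D Q \<tau> D' Q' \<tau>'
  proof -
    obtain d \<beta> d' \<beta>' where D: "D = (d, \<beta>)" "D' = (d', \<beta>')" by (cases D; cases D')
    obtain G where G: "bqf_equiv Q G" "bqf_primitive G" "bqf_pos_def G" "bqf_disc G = - d"
      "bqf_at G \<tau> = 0" "Im \<tau> > 0"
      using outcome_form o(1) N(1) unfolding D by blast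
    obtain G' where G': "bqf_equiv Q' G'" "bqf_primitive G'" "bqf_pos_def G'" "bqf_disc G' = - d'"
      "bqf_at G' \<tau>' = 0"
      using outcome_form o(2) N(1) unfolding D by blast
    have eq: "bqf_equiv G' G"
      using related_roots_equiv[OF G(2) G'(2) G(3) G'(3) G(5) G'(5) G(6) rel] .
    then have "d = d'" using bqf_disc_equiv[OF eq] G(4) G'(4) by simp
    moreover have "step1 N (d, \<beta>)" "step1 N (d', \<beta>')" using o by (auto simp: outcome_def D)
    ultimately have "\<beta> = \<beta>'" using N by (auto simp: step1_def)
    have "bqf_equiv Q Q'"
      using G(1) eq G'(1) bqf_equiv_sym bqf_equiv_trans by blast
    then have "Q = Q'"
      using o by (intro reduced_unique) (auto simp: outcome_def initial_form_def D)
    then show ?thesis using \<open>d = d'\<close> \<open>\<beta> = \<beta>'\<close> D by simp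
  qed
  show ?thesis
  proof (intro conjI allI impI; (elim conjE)?)
    fix d \<beta> Q
    assume "step1 N (d, \<beta>)" "initial_form d Q"
    then show "\<exists>F. step2 N Q F" using step2 by blast
  next
    fix d \<beta> Q F
    assume "step1 N (d, \<beta>)" "initial_form d Q" "step2 N Q F"
    then show "\<exists>K. step3_solution N \<beta> F K"
      using step3_solvable[of N d \<beta> F] step2_props[of d Q N F] N by blast
  qed (use result inequiv in \<open>blast+\<close>)
qed

end
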